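(* Let $X$ be a real Banach space, and let $\mathcal Y_X=\overline{\operatorname{span}}\{S_a\mu-\mu: a\in X,\ \mu\in\mathcal F(X)\}\subseteq\mathcal F(X)$ (norm closure). Then $$\ker(\beta_X)=\mathcal Y_X=\overline{\operatorname{span}}\{\delta_{x+a}-\delta_x-\delta_a: x,a\in X\},$$ and $\mathcal F(X)/\ker(\beta_X)\cong X$ canonically and linearly isometrically.
   Context: $\operatorname{Lip}_0(X)$ is the Banach space of Lipschitz functions $f\colon X\to\mathbb R$ with $f(0)=0$, normed by the least Lipschitz constant. For $x\in X$, $\delta_x\in\operatorname{Lip}_0(X)^*$ is evaluation at $x$, and $\mathcal F(X)=\overline{\operatorname{span}}\{\delta_x:x\in X\}\subseteq\operatorname{Lip}_0(X)^*$ is the Lipschitz-free space. The barycentre map $\beta_X\colon\mathcal F(X)\to X$ is the unique bounded linear operator with $\beta_X(\delta_x)=x$ for all $x\in X$. For $a\in X$, $S_a\colon\mathcal F(X)\to\mathcal F(X)$ is the unique bounded linear operator (a surjective linear isometry) with $S_a\delta_x=\delta_{x+a}-\delta_a$ for all $x\in X$. *)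

theory Defs
  imports "HOL-Analysis.Analysis"
begin

section \<open>The space of Lipschitz functions vanishing at the origin\<close>

typedef (overloaded) 'a lip0 =
  "{f :: 'a::real_normed_vector \<Rightarrow> real. f 0 = 0 \<and> (\<exists>L. L-lipschitz_on UNIV f)}"
  morphisms lip0_apply Lip0
  by (rule exI[of _ "\<lambda>_. 0"]) (auto intro!: exI[of _ 0] lipschitz_onI)

setup_lifting type_definition_lip0

instantiation lip0 :: (real_normed_vector) real_vector
begin

lift_definition zero_lip0 :: "'a lip0" is "\<lambda>_. 0"
  by (auto intro!: exI[of _ 0] lipschitz_onI)

lift_definition plus_lip0 :: "'a lip0 \<Rightarrow> 'a lip0 \<Rightarrow> 'a lip0" is "\<lambda>f g x. f x + g x"
  by (auto intro: lipschitz_on_add)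

lift_definition uminus_lip0 :: "'a lip0 \<Rightarrow> 'a lip0" is "\<lambda>f x. - f x"
  by (auto intro: lipschitz_on_minus)

lift_definition minus_lip0 :: "'a lip0 \<Rightarrow> 'a lip0 \<Rightarrow> 'a lip0" is "\<lambda>f g x. f x - g x"
  by (auto intro: lipschitz_on_diff)

lift_definition scaleR_lip0 :: "real \<Rightarrow> 'a lip0 \<Rightarrow> 'a lip0" is "\<lambda>r f x. r * f x"
  by (auto intro: lipschitz_on_cmult_real)

instance
  by standard (transfer; simp add: fun_eq_iff algebra_simps)+

end

instantiation lip0 :: (real_normed_vector) real_normed_vector
begin

lift_definition norm_lip0 :: "'a lip0 \<Rightarrow> real" is "\<lambda>f. Inf {L. L-lipschitz_on UNIV f}" .

definition dist_lip0 :: "'a lip0 \<Rightarrow> 'a lip0 \<Rightarrow> real"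
  where "dist_lip0 f g = norm (f - g)"

definition uniformity_lip0 :: "('a lip0 \<times> 'a lip0) filter"
  where "uniformity_lip0 = (INF e\<in>{0 <..}. principal {(x, y). dist x y < e})"

definition open_lip0 :: "'a lip0 set \<Rightarrow> bool"
  where "open_lip0 S = (\<forall>x\<in>S. \<forall>\<^sub>F (x', y) in uniformity. x' = x \<longrightarrow> y \<in> S)"

definition sgn_lip0 :: "'a lip0 \<Rightarrow> 'a lip0"
  where "sgn_lip0 f = f /\<^sub>R norm f"

lemma norm_lip0_lipschitz: "(norm f)-lipschitz_on UNIV (lip0_apply f)"
proof transfer
  fix f :: "'a \<Rightarrow> real"
  let ?S = "{L. L-lipschitz_on UNIV f}"
  assume "f 0 = 0 \<and> (\<exists>L. L-lipschitz_on UNIV f)"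
  then have ne: "?S \<noteq> {}" by auto
  show "(Inf ?S)-lipschitz_on UNIV f"
  proof (rule lipschitz_onI)
    show "0 \<le> Inf ?S" using ne by (auto intro!: cInf_greatest dest: lipschitz_on_nonneg)
    fix x y :: 'a
    show "dist (f x) (f y) \<le> Inf ?S * dist x y"
    proof (cases "x = y")
      case False
      then have "dist (f x) (f y) / dist x y \<le> Inf ?S"
        using ne by (intro cInf_greatest) (auto simp: divide_simps dest: lipschitz_onD)
      then show ?thesis using False by (simp add: divide_simps)
    qed simp
  qed
qed

lemma norm_lip0_le: "L-lipschitz_on UNIV (lip0_apply f) \<Longrightarrow> norm f \<le> L"
  by transfer (auto intro!: cInf_lower bdd_belowI[of _ 0] dest: lipschitz_on_nonneg)

instance
proof
  fix f g :: "'a lip0" and a :: real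
  have nonneg: "0 \<le> norm h" for h :: "'a lip0"
    using norm_lip0_lipschitz lipschitz_on_nonneg by blast
  have app: "lip0_apply (f + g) = (\<lambda>x. lip0_apply f x + lip0_apply g x)"
    "lip0_apply (b *\<^sub>R h) = (\<lambda>x. b * lip0_apply h x)" for b h
    by (transfer; simp)+
  show "norm f = 0 \<longleftrightarrow> f = 0"
  proof
    assume "norm f = 0"
    then have L: "0-lipschitz_on UNIV (lip0_apply f)" using norm_lip0_lipschitz[of f] by simp
    have "lip0_apply f x = lip0_apply f 0" for x
      using lipschitz_onD[OF L, of x 0] by simp
    then show "f = 0" by transfer auto
  next
    assume "f = 0"
    then have "norm f \<le> 0"
      by (intro norm_lip0_le) (auto simp: zero_lip0.rep_eq intro: lipschitz_onI)
    then show "norm f = 0" using nonneg[of f] by simp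
  qed
  show "norm (f + g) \<le> norm f + norm g"
    by (intro norm_lip0_le) (simp add: app lipschitz_on_add norm_lip0_lipschitz)
  have le: "norm (b *\<^sub>R h) \<le> \<bar>b\<bar> * norm h" for b and h :: "'a lip0"
    by (intro norm_lip0_le) (simp add: app lipschitz_on_cmult_real norm_lip0_lipschitz)
  show "norm (a *\<^sub>R f) = \<bar>a\<bar> * norm f"
  proof (cases "a = 0")
    case True
    then show ?thesis using le[of a f] nonneg[of "a *\<^sub>R f"] by simp
  next
    case False
    then have "norm f \<le> \<bar>inverse a\<bar> * norm (a *\<^sub>R f)"
      using le[of "inverse a" "a *\<^sub>R f"] by simp
    then have "\<bar>a\<bar> * norm f \<le> norm (a *\<^sub>R f)"
      using False by (simp add: field_simps)
    then show ?thesis using le[of a f] by simp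
  qed
qed (rule dist_lip0_def uniformity_lip0_def open_lip0_def sgn_lip0_def)+

end

section \<open>The Lipschitz-free space\<close>

definition lip0_eval :: "'a::real_normed_vector \<Rightarrow> ('a lip0 \<Rightarrow>\<^sub>L real)"
  where "lip0_eval x = Blinfun (\<lambda>f. lip0_apply f x)"

lemma lip0_eval_apply [simp]: "blinfun_apply (lip0_eval x) f = lip0_apply f x"
proof -
  have "bounded_linear (\<lambda>f. lip0_apply f x)"
  proof (rule bounded_linear_intro[where K = "norm x"])
    fix f :: "'a lip0"
    have "lip0_apply f 0 = 0" by transfer simp
    then show "norm (lip0_apply f x) \<le> norm f * norm x"
      using lipschitz_onD[OF norm_lip0_lipschitz[of f], of x 0] by simp
  qed (transfer; simp)+
  then show ?thesis by (simp add: lip0_eval_def bounded_linear_Blinfun_apply)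
qed

typedef (overloaded) 'a lipfree =
  "closure (span (range (lip0_eval :: 'a::real_normed_vector \<Rightarrow> _)))"
  morphisms lipfree_functional Abs_lipfree
  by (rule exI[of _ 0], rule subsetD[OF closure_subset], rule span_zero)

setup_lifting type_definition_lipfree

lemma subspace_closure:
  fixes S :: "'b::real_normed_vector set"
  assumes "subspace S"
  shows "subspace (closure S)"
proof (rule subspaceI)
  show "0 \<in> closure S" using assms closure_subset subspace_0 by blast
next
  fix x y assume "x \<in> closure S" "y \<in> closure S"
  then obtain u v where "\<And>n. u n \<in> S" "u \<longlonglongrightarrow> x" "\<And>n. v n \<in> S" "v \<longlonglongrightarrow> y"
    unfolding closure_sequential by blast
  then show "x + y \<in> closure S"
    unfolding closure_sequential
    by (intro exI[of _ "\<lambda>n. u n + v n"]) (auto intro: tendsto_add subspace_add[OF assms])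
next
  fix c x assume "x \<in> closure S"
  then obtain u where "\<And>n. u n \<in> S" "u \<longlonglongrightarrow> x"
    unfolding closure_sequential by blast
  then show "c *\<^sub>R x \<in> closure S"
    unfolding closure_sequential
    by (intro exI[of _ "\<lambda>n. c *\<^sub>R u n"]) (auto intro: tendsto_intros subspace_scale[OF assms])
qed

lemmas subspace_lipfree = subspace_closure[OF subspace_span, of "range lip0_eval"]

instantiation lipfree :: (real_normed_vector) real_vector
begin

lift_definition zero_lipfree :: "'a lipfree" is 0
  by (rule subspace_0[OF subspace_lipfree])

lift_definition plus_lipfree :: "'a lipfree \<Rightarrow> 'a lipfree \<Rightarrow> 'a lipfree" is "(+)"
  by (rule subspace_add[OF subspace_lipfree])

lift_definition uminus_lipfree :: "'a lipfree \<Rightarrow> 'a lipfree" is uminus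
  by (rule subspace_neg[OF subspace_lipfree])

lift_definition minus_lipfree :: "'a lipfree \<Rightarrow> 'a lipfree \<Rightarrow> 'a lipfree" is "(-)"
  by (rule subspace_diff[OF subspace_lipfree])

lift_definition scaleR_lipfree :: "real \<Rightarrow> 'a lipfree \<Rightarrow> 'a lipfree" is "(*\<^sub>R)"
  by (rule subspace_scale[OF subspace_lipfree])

instance
  by standard (transfer; simp add: algebra_simps)+

end

instantiation lipfree :: (real_normed_vector) real_normed_vector
begin

lift_definition norm_lipfree :: "'a lipfree \<Rightarrow> real" is norm .

definition dist_lipfree :: "'a lipfree \<Rightarrow> 'a lipfree \<Rightarrow> real"
  where "dist_lipfree f g = norm (f - g)"

definition uniformity_lipfree :: "('a lipfree \<times> 'a lipfree) filter"
  where "uniformity_lipfree = (INF e\<in>{0 <..}. principal {(x, y). dist x y < e})"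

definition open_lipfree :: "'a lipfree set \<Rightarrow> bool"
  where "open_lipfree S = (\<forall>x\<in>S. \<forall>\<^sub>F (x', y) in uniformity. x' = x \<longrightarrow> y \<in> S)"

definition sgn_lipfree :: "'a lipfree \<Rightarrow> 'a lipfree"
  where "sgn_lipfree f = f /\<^sub>R norm f"

instance
proof
  fix f g :: "'a lipfree" and a :: real
  show "norm f = 0 \<longleftrightarrow> f = 0" by transfer simp
  show "norm (f + g) \<le> norm f + norm g" by transfer (rule norm_triangle_ineq)
  show "norm (a *\<^sub>R f) = \<bar>a\<bar> * norm f" by transfer simp
qed (rule dist_lipfree_def uniformity_lipfree_def open_lipfree_def sgn_lipfree_def)+

end

lift_definition lipfree_delta :: "'a::real_normed_vector \<Rightarrow> 'a lipfree" is lip0_eval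
  by (rule subsetD[OF closure_subset], rule span_base, rule rangeI)

text \<open>The operators below are determined by their values on the point evaluations because these
  span a dense subspace of the free space.\<close>

definition barycentre :: "'a::banach lipfree \<Rightarrow>\<^sub>L 'a"
  where "barycentre = (THE b. \<forall>x. blinfun_apply b (lipfree_delta x) = x)"

definition lipfree_shift :: "'a::banach \<Rightarrow> ('a lipfree \<Rightarrow>\<^sub>L 'a lipfree)"
  where "lipfree_shift a =
    (THE S. \<forall>x. blinfun_apply S (lipfree_delta x) = lipfree_delta (x + a) - lipfree_delta a)"

definition ker_barycentre :: "'a::banach lipfree set"
  where "ker_barycentre = {\<mu>. blinfun_apply barycentre \<mu> = 0}"

definition shift_space :: "'a::banach lipfree set"
  where "shift_space = closure (span {blinfun_apply (lipfree_shift a) \<mu> - \<mu> | a \<mu>. True})"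

section \<open>The quotient by the kernel of the barycentre map\<close>

quotient_type (overloaded) 'a lipfree_quot = "'a::banach lipfree" /
    "\<lambda>\<mu> \<nu>. \<mu> - \<nu> \<in> ker_barycentre"
  morphisms lipfree_quot_rep lipfree_class
  by (auto intro!: equivpI reflpI sympI transpI simp: ker_barycentre_def blinfun.diff_right)

lemma lipfree_class_eq_iff: "lipfree_class \<mu> = lipfree_class \<nu> \<longleftrightarrow> \<mu> - \<nu> \<in> ker_barycentre"
  by (rule lipfree_quot.abs_eq_iff)

lemma lipfree_class_surj: obtains \<mu> where "q = lipfree_class \<mu>"
  using lipfree_quot.abs_induct[of "\<lambda>q. \<exists>\<mu>. q = lipfree_class \<mu>" q] by blast

lemma lipfree_class_nonempty: "{\<mu>. lipfree_class \<mu> = q} \<noteq> {}"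
  using lipfree_class_surj[of q] by blast

instantiation lipfree_quot :: (banach) real_vector
begin

lift_definition zero_lipfree_quot :: "'a lipfree_quot" is 0 .

lift_definition plus_lipfree_quot :: "'a lipfree_quot \<Rightarrow> 'a lipfree_quot \<Rightarrow> 'a lipfree_quot"
  is "(+)" by (simp add: ker_barycentre_def blinfun.diff_right blinfun.add_right)

lift_definition uminus_lipfree_quot :: "'a lipfree_quot \<Rightarrow> 'a lipfree_quot"
  is uminus by (simp add: ker_barycentre_def blinfun.diff_right blinfun.minus_right)

lift_definition minus_lipfree_quot :: "'a lipfree_quot \<Rightarrow> 'a lipfree_quot \<Rightarrow> 'a lipfree_quot"
  is "(-)" by (simp add: ker_barycentre_def blinfun.diff_right)

lift_definition scaleR_lipfree_quot :: "real \<Rightarrow> 'a lipfree_quot \<Rightarrow> 'a lipfree_quot"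
  is "(*\<^sub>R)" by (simp add: ker_barycentre_def blinfun.diff_right blinfun.scaleR_right)

instance
  by standard
    (transfer; simp add: ker_barycentre_def blinfun.diff_right blinfun.add_right
      blinfun.minus_right blinfun.scaleR_right algebra_simps)+

end

instantiation lipfree_quot :: (banach) real_normed_vector
begin

definition norm_lipfree_quot :: "'a lipfree_quot \<Rightarrow> real"
  where "norm_lipfree_quot q = (INF \<mu>\<in>{\<mu>. lipfree_class \<mu> = q}. norm \<mu>)"

definition dist_lipfree_quot :: "'a lipfree_quot \<Rightarrow> 'a lipfree_quot \<Rightarrow> real"
  where "dist_lipfree_quot p q = norm (p - q)"

definition uniformity_lipfree_quot :: "('a lipfree_quot \<times> 'a lipfree_quot) filter"
  where "uniformity_lipfree_quot = (INF e\<in>{0 <..}. principal {(x, y). dist x y < e})"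

definition open_lipfree_quot :: "'a lipfree_quot set \<Rightarrow> bool"
  where "open_lipfree_quot S = (\<forall>x\<in>S. \<forall>\<^sub>F (x', y) in uniformity. x' = x \<longrightarrow> y \<in> S)"

definition sgn_lipfree_quot :: "'a lipfree_quot \<Rightarrow> 'a lipfree_quot"
  where "sgn_lipfree_quot q = q /\<^sub>R norm q"

lemma norm_lipfree_class_le: "norm (lipfree_class \<mu>) \<le> norm \<mu>"
  unfolding norm_lipfree_quot_def
  by (rule cINF_lower) (auto intro: bdd_belowI[of _ 0])

lemma norm_lipfree_quot_nonneg: "0 \<le> norm (q :: 'a lipfree_quot)"
  unfolding norm_lipfree_quot_def
  by (rule cINF_greatest[OF lipfree_class_nonempty]) simp

lemma norm_lipfree_quot_approx:
  fixes q :: "'a lipfree_quot"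
  assumes "0 < e"
  obtains \<mu> where "lipfree_class \<mu> = q" "norm \<mu> < norm q + e"
proof -
  have "(INF \<mu>\<in>{\<mu>. lipfree_class \<mu> = q}. norm \<mu>) < norm q + e"
    using assms by (simp add: norm_lipfree_quot_def)
  then obtain \<mu> where "\<mu> \<in> {\<mu>. lipfree_class \<mu> = q}" "norm \<mu> < norm q + e"
    using lipfree_class_nonempty by (subst (asm) cINF_less_iff) (auto intro: bdd_belowI[of _ 0])
  then show thesis using that by blast
qed

instance
proof
  fix p q :: "'a lipfree_quot" and r :: real
  show "norm q = 0 \<longleftrightarrow> q = 0"
  proof
    assume n0: "norm q = 0"
    obtain \<mu> where \<mu>: "q = lipfree_class \<mu>" by (rule lipfree_class_surj)
    let ?K = "norm (barycentre :: 'a lipfree \<Rightarrow>\<^sub>L 'a)"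
    have "norm (barycentre \<mu>) \<le> 0 + e" if "0 < e" for e
    proof -
      have K: "0 < ?K + 1" using norm_ge_zero[of "barycentre :: 'a lipfree \<Rightarrow>\<^sub>L 'a"] by linarith
      then have "0 < e / (?K + 1)" using that by simp
      then obtain \<nu> where \<nu>: "lipfree_class \<nu> = q" "norm \<nu> < norm q + e / (?K + 1)"
        by (rule norm_lipfree_quot_approx)
      then have "barycentre \<mu> = barycentre \<nu>"
        using \<mu> by (simp add: lipfree_class_eq_iff ker_barycentre_def blinfun.diff_right)
      then have "norm (barycentre \<mu>) \<le> ?K * norm \<nu>" by (simp add: norm_blinfun)
      also have "\<dots> \<le> (?K + 1) * norm \<nu>" by (simp add: mult_right_mono)
      also have "\<dots> \<le> (?K + 1) * (e / (?K + 1))"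
        using \<nu> n0 K by (intro mult_left_mono) auto
      finally show ?thesis using K by simp
    qed
    then have "barycentre \<mu> = 0" using field_le_epsilon[of "norm (barycentre \<mu>)" 0] by simp
    then show "q = 0"
      unfolding \<mu> zero_lipfree_quot_def by (simp add: lipfree_class_eq_iff ker_barycentre_def)
  next
    assume "q = 0"
    then have "norm q \<le> 0" using norm_lipfree_class_le[of 0] by (simp add: zero_lipfree_quot_def)
    then show "norm q = 0" using norm_lipfree_quot_nonneg[of q] by simp
  qed
  show "norm (p + q) \<le> norm p + norm q"
  proof (rule field_le_epsilon)
    fix e :: real assume "0 < e"
    then have e: "0 < e / 2" by simp
    obtain \<mu> where \<mu>: "lipfree_class \<mu> = p" "norm \<mu> < norm p + e / 2"
      using e by (rule norm_lipfree_quot_approx)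
    obtain \<nu> where \<nu>: "lipfree_class \<nu> = q" "norm \<nu> < norm q + e / 2"
      using e by (rule norm_lipfree_quot_approx)
    have "p + q = lipfree_class (\<mu> + \<nu>)"
      using \<mu> \<nu> by (simp add: plus_lipfree_quot.abs_eq[symmetric])
    then have "norm (p + q) \<le> norm (\<mu> + \<nu>)" by (simp add: norm_lipfree_class_le)
    also have "\<dots> \<le> norm \<mu> + norm \<nu>" by (rule norm_triangle_ineq)
    finally show "norm (p + q) \<le> norm p + norm q + e" using \<mu> \<nu> by simp
  qed
  have le: "norm (r *\<^sub>R q) \<le> \<bar>r\<bar> * norm q" for r and q :: "'a lipfree_quot"
  proof (rule field_le_epsilon)
    fix e :: real assume e: "0 < e"
    then have "0 < e / (\<bar>r\<bar> + 1)" by simp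
    then obtain \<mu> where \<mu>: "lipfree_class \<mu> = q" "norm \<mu> < norm q + e / (\<bar>r\<bar> + 1)"
      by (rule norm_lipfree_quot_approx)
    have "r *\<^sub>R q = lipfree_class (r *\<^sub>R \<mu>)"
      using \<mu> by (simp add: scaleR_lipfree_quot.abs_eq[symmetric])
    then have "norm (r *\<^sub>R q) \<le> norm (r *\<^sub>R \<mu>)"
      using norm_lipfree_class_le[of "r *\<^sub>R \<mu>"] by simp
    also have "\<dots> \<le> \<bar>r\<bar> * (norm q + e / (\<bar>r\<bar> + 1))"
      using \<mu> by (simp add: mult_left_mono)
    also have "\<dots> \<le> \<bar>r\<bar> * norm q + e"
      using e by (simp add: field_simps)
    finally show "norm (r *\<^sub>R q) \<le> \<bar>r\<bar> * norm q + e" .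
  qed
  show "norm (r *\<^sub>R q) = \<bar>r\<bar> * norm q"
  proof (cases "r = 0")
    case True
    then show ?thesis using le[of r q] norm_lipfree_quot_nonneg[of "r *\<^sub>R q"] by simp
  next
    case False
    then have "norm q \<le> \<bar>inverse r\<bar> * norm (r *\<^sub>R q)"
      using le[of "inverse r" "r *\<^sub>R q"] by simp
    then have "\<bar>r\<bar> * norm q \<le> norm (r *\<^sub>R q)"
      using False by (simp add: field_simps)
    then show ?thesis using le[of r q] by simp
  qed
qed (rule dist_lipfree_quot_def uniformity_lipfree_quot_def open_lipfree_quot_def
    sgn_lipfree_quot_def)+

end

end

theory Submission
  imports Defs
begin

text \<open>Write \<open>\<beta>\<close> for the barycentre map and \<open>Z\<close> for the closed span of the elements
  \<open>\<delta>\<^bsub>x+a\<^esub> - \<delta>\<^sub>x - \<delta>\<^sub>a\<close>.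

  Modulo \<open>Z\<close> the map \<open>x \<mapsto> \<delta>\<^sub>x\<close> is additive. It is also continuous and \<open>Z\<close> is closed, so it is
  even real-linear modulo \<open>Z\<close> (\<open>additive_modulo_imp_homogeneous_modulo\<close>). Hence a combination
  \<open>\<Sum>c\<^sub>i \<delta>\<^bsub>x\<^sub>i\<^esub>\<close> is congruent to the single point mass at its barycentre \<open>\<Sum>c\<^sub>i x\<^sub>i\<close>, and by
  density \<open>\<mu> - \<delta>\<^bsub>\<beta>\<mu>\<^esub> \<in> Z\<close> for every \<open>\<mu>\<close> (\<open>minus_delta_barycentre_mem\<close>). Elements of the kernel
  satisfy \<open>\<delta>\<^bsub>\<beta>\<mu>\<^esub> = \<delta>\<^sub>0 = 0\<close> and so lie in \<open>Z\<close>. The other inclusions are short: each generator of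
  \<open>Z\<close> is \<open>S\<^sub>a \<delta>\<^sub>x - \<delta>\<^sub>x\<close>, and \<open>\<beta> \<circ> S\<^sub>a = \<beta>\<close> because both sides agree on point masses.

  The map induced by \<open>\<beta>\<close> on the quotient is isometric because \<open>\<beta>\<close> has norm at most one, while the
  class of \<open>\<mu>\<close> contains \<open>\<delta>\<^bsub>\<beta>\<mu>\<^esub>\<close>, whose norm is at most \<open>\<parallel>\<beta>\<mu>\<parallel>\<close>.

  This uses that \<open>\<beta>\<close> and \<open>S\<^sub>a\<close> exist. The shift is the restriction to the free space of the adjoint of
  the translation \<open>f \<mapsto> f (\<sqdot> + a) - f a\<close> of Lipschitz functions. For \<open>\<beta>\<close>, the point is
  the inequality \<open>\<parallel>\<Sum>c\<^sub>i x\<^sub>i\<parallel> \<le> \<parallel>\<Sum>c\<^sub>i \<delta>\<^bsub>x\<^sub>i\<^esub>\<parallel>\<close>, which says that some 1-Lipschitz function sees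
  the whole norm of \<open>w = \<Sum>c\<^sub>i x\<^sub>i\<close>. The Hahn--Banach theorem would give a linear one; a sublinear
  function below the norm suffices if it is odd at \<open>w\<close> and at the finitely many points \<open>x\<^sub>i\<close>, and finitely
  many elementary steps of the Hahn--Banach argument produce it.\<close>

section \<open>Sublinear functions that are linear along finitely many lines\<close>

definition sublinear :: "('a::real_vector \<Rightarrow> real) \<Rightarrow> bool"
  where "sublinear p \<longleftrightarrow>
    (\<forall>x y. p (x + y) \<le> p x + p y) \<and> (\<forall>t x. 0 \<le> t \<longrightarrow> p (t *\<^sub>R x) = t * p x)"

lemma sublinear_add: "sublinear p \<Longrightarrow> p (x + y) \<le> p x + p y"
  and sublinear_scale: "sublinear p \<Longrightarrow> 0 \<le> t \<Longrightarrow> p (t *\<^sub>R x) = t * p x"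
  by (auto simp: sublinear_def)

lemma sublinear_zero: "sublinear p \<Longrightarrow> p 0 = 0"
  using sublinear_scale[of p 0 0] by simp

lemma sublinear_neg: "sublinear p \<Longrightarrow> - p x \<le> p (- x)"
  using sublinear_add[of p x "- x"] sublinear_zero[of p] by simp

lemma sublinear_norm: "sublinear (norm :: 'a::real_normed_vector \<Rightarrow> real)"
  by (auto simp: sublinear_def norm_triangle_ineq)

lemma sublinear_sum:
  assumes "sublinear p" "finite A"
  shows "p (\<Sum>i\<in>A. f i) \<le> (\<Sum>i\<in>A. p (f i))"
  using assms(2)
proof induction
  case empty
  then show ?case using sublinear_zero[OF assms(1)] by simp
next
  case (insert i A)
  then show ?case using sublinear_add[OF assms(1), of "f i" "sum f A"] by simp
qed

text \<open>The largest sublinear function below \<open>p\<close> that takes the value \<open>- p y\<close> at \<open>- y\<close> is the infimum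
  of \<open>p (x + t y) - t p y\<close> over \<open>t \<ge> 0\<close>, the limit of \<open>p\<close> seen from far out in direction \<open>y\<close>;
  it makes \<open>p\<close> linear along the line through \<open>y\<close>.\<close>

lemma sublinear_step:
  assumes p: "sublinear p"
  obtains q where "sublinear q" "\<And>x. q x \<le> p x" "q (- y) \<le> - p y"
proof
  define q where "q x = (INF t\<in>{0..}. p (x + t *\<^sub>R y) - t * p y)" for x
  have bdd: "bdd_below ((\<lambda>t. p (x + t *\<^sub>R y) - t * p y) ` {0..})" for x
  proof (rule bdd_belowI2)
    fix t :: real assume t: "t \<in> {0..}"
    have "p ((x + t *\<^sub>R y) + (- x)) \<le> p (x + t *\<^sub>R y) + p (- x)" by (rule sublinear_add[OF p])
    then show "- p (- x) \<le> p (x + t *\<^sub>R y) - t * p y"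
      using sublinear_scale[OF p, of t y] t by simp
  qed
  have le: "q x \<le> p (x + t *\<^sub>R y) - t * p y" if "0 \<le> t" for x t
    unfolding q_def using that by (intro cINF_lower[OF bdd]) simp
  have ge: "c \<le> q x" if "\<And>t. 0 \<le> t \<Longrightarrow> c \<le> p (x + t *\<^sub>R y) - t * p y" for x c
    unfolding q_def using that by (intro cINF_greatest) auto
  show "q x \<le> p x" for x using le[of 0 x] by simp
  show "q (- y) \<le> - p y" using le[of 1 "- y"] sublinear_zero[OF p] by simp
  have add: "q (x + z) \<le> q x + q z" for x z
  proof -
    have "q (x + z) - (p (z + s *\<^sub>R y) - s * p y) \<le> q x" if s: "0 \<le> s" for s
    proof (rule ge)
      fix t :: real assume t: "0 \<le> t"
      have "q (x + z) \<le> p ((x + z) + (t + s) *\<^sub>R y) - (t + s) * p y"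
        using s t by (intro le) simp
      moreover have "p ((x + t *\<^sub>R y) + (z + s *\<^sub>R y)) \<le> p (x + t *\<^sub>R y) + p (z + s *\<^sub>R y)"
        by (rule sublinear_add[OF p])
      moreover have "(x + z) + (t + s) *\<^sub>R y = (x + t *\<^sub>R y) + (z + s *\<^sub>R y)"
        by (simp add: algebra_simps)
      ultimately show "q (x + z) - (p (z + s *\<^sub>R y) - s * p y) \<le> p (x + t *\<^sub>R y) - t * p y"
        by (simp add: algebra_simps)
    qed
    then have "q (x + z) - q x \<le> q z" by (intro ge) (simp add: algebra_simps)
    then show ?thesis by simp
  qed
  have scale_le: "q (r *\<^sub>R x) \<le> r * q x" if r: "0 < r" for r x
  proof -
    have "q (r *\<^sub>R x) / r \<le> q x"
    proof (rule ge)
      fix t :: real assume t: "0 \<le> t"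
      have "q (r *\<^sub>R x) \<le> p (r *\<^sub>R x + (r * t) *\<^sub>R y) - (r * t) * p y"
        using r t by (intro le) simp
      also have "r *\<^sub>R x + (r * t) *\<^sub>R y = r *\<^sub>R (x + t *\<^sub>R y)" by (simp add: algebra_simps)
      also have "p \<dots> = r * p (x + t *\<^sub>R y)" using r by (intro sublinear_scale[OF p]) simp
      finally show "q (r *\<^sub>R x) / r \<le> p (x + t *\<^sub>R y) - t * p y"
        using r by (simp add: field_simps)
    qed
    then show ?thesis using r by (simp add: field_simps)
  qed
  have "q 0 \<le> 0" using le[of 0 0] sublinear_zero[OF p] by simp
  moreover have "0 \<le> q 0"
    by (rule ge) (simp add: sublinear_scale[OF p])
  ultimately have zero: "q 0 = 0" by simp
  have "q (r *\<^sub>R x) = r * q x" if "0 \<le> r" for r x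
  proof (cases "r = 0")
    case False
    with that have r: "0 < r" by simp
    have "r * q x \<le> q (r *\<^sub>R x)"
      using scale_le[of "inverse r" "r *\<^sub>R x"] r by (simp add: field_simps)
    then show ?thesis using scale_le[OF r, of x] by simp
  qed (simp add: zero)
  then show "sublinear q" using add by (auto simp: sublinear_def)
qed

text \<open>A sublinear function below \<open>q\<close> cannot lose the oddness of \<open>q\<close> at \<open>a\<close>: its values at \<open>a\<close> and
  \<open>- a\<close> are at most those of \<open>q\<close>, which sum to zero, and by sublinearity their own sum
  is nonnegative. So the points can be treated one after another.\<close>

lemma sublinear_odd_on_finite:
  assumes "finite A" "sublinear p"
  obtains q where "sublinear q" "\<And>x. q x \<le> p x" "\<And>a. a \<in> A \<Longrightarrow> q (- a) = - q a"
proof -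
  have "\<exists>q. sublinear q \<and> (\<forall>x. q x \<le> p x) \<and> (\<forall>a\<in>A. q (- a) = - q a)"
    using assms
  proof induction
    case (insert y A)
    then obtain q where q: "sublinear q" "\<And>x. q x \<le> p x" "\<And>a. a \<in> A \<Longrightarrow> q (- a) = - q a"
      by blast
    obtain r where r: "sublinear r" "\<And>x. r x \<le> q x" "r (- y) \<le> - q y"
      using sublinear_step[OF q(1)] by blast
    have "r (- a) = - r a" if "a \<in> insert y A" for a
    proof (rule antisym)
      have "r (- a) \<le> - q a" using that r(3) q(3)[of a] r(2)[of "- a"] by auto
      also have "\<dots> \<le> - r a" using r(2)[of a] by simp
      finally show "r (- a) \<le> - r a" .
      show "- r a \<le> r (- a)" by (rule sublinear_neg[OF r(1)])
    qed
    moreover have "r x \<le> p x" for x using r(2)[of x] q(2)[of x] by simp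
    ultimately show ?case using r(1) by blast
  qed auto
  then show thesis using that by blast
qed

lemma sublinear_lipschitz:
  assumes q: "sublinear q" "\<And>x. q x \<le> norm x"
  shows "1-lipschitz_on UNIV q"
proof (rule lipschitz_onI)
  fix x y :: 'a
  have "q x - q y \<le> norm (x - y)" "q y - q x \<le> norm (x - y)"
    using sublinear_add[OF q(1), of "x - y" y] sublinear_add[OF q(1), of "y - x" x]
      q(2)[of "x - y"] q(2)[of "y - x"] by (simp_all add: norm_minus_commute)
  then show "dist (q x) (q y) \<le> 1 * dist x y" by (simp add: dist_norm dist_real_def abs_le_iff)
qed simp

section \<open>Density of the point masses\<close>

lemma lipfree_functional_linear: "linear lipfree_functional"
  by (rule linearI) (transfer; simp)+

lemma lipfree_functional_span:
  "lipfree_functional ` span (range lipfree_delta) = span (range lip0_eval)"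
proof -
  have "lipfree_functional ` range lipfree_delta = range lip0_eval"
    by (simp add: image_image lipfree_delta.rep_eq)
  then show ?thesis using linear_span_image[OF lipfree_functional_linear] by metis
qed

lemma lipfree_functional_dist:
  "dist (lipfree_functional \<mu>) (lipfree_functional \<nu>) = dist \<mu> \<nu>"
  unfolding dist_norm dist_lipfree_def by transfer simp

lemma lipfree_delta_dense: "closure (span (range lipfree_delta)) = (UNIV :: 'a::real_normed_vector lipfree set)"
proof -
  have "\<mu> \<in> closure (span (range lipfree_delta))" for \<mu> :: "'a lipfree"
    unfolding closure_approachable
  proof (intro allI impI)
    fix e :: real assume "0 < e"
    then obtain u where "u \<in> span (range lip0_eval)" "dist u (lipfree_functional \<mu>) < e"
      using lipfree_functional[of \<mu>] unfolding closure_approachable by blast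
    then show "\<exists>\<nu>\<in>span (range lipfree_delta). dist \<nu> \<mu> < e"
      unfolding lipfree_functional_span[symmetric] by (auto simp: lipfree_functional_dist)
  qed
  then show ?thesis by blast
qed

lemma lipfree_blinfun_eqI:
  fixes S T :: "'a::real_normed_vector lipfree \<Rightarrow>\<^sub>L 'b::real_normed_vector"
  assumes "\<And>x. S (lipfree_delta x) = T (lipfree_delta x)"
  shows "S = T"
proof (rule blinfun_eqI)
  fix \<mu>
  let ?K = "{\<mu>. blinfun_apply S \<mu> = blinfun_apply T \<mu>}"
  have "span (range lipfree_delta) \<subseteq> ?K"
    by (rule span_minimal) (auto simp: assms subspace_def blinfun.bilinear_simps)
  moreover have "closed ?K" by (intro closed_Collect_eq continuous_intros)
  ultimately show "S \<mu> = T \<mu>"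
    using closure_minimal[of "span (range lipfree_delta)" ?K] lipfree_delta_dense by auto
qed

section \<open>Existence of the barycentre map\<close>

text \<open>The sum on the right is tested against a 1-Lipschitz \<open>q\<close> that has \<open>q w = \<parallel>w\<parallel>\<close> at the left-hand
  sum \<open>w\<close> and is odd at the points of \<open>A\<close>. Then \<open>q (c x) = c q x\<close> holds for negative
  \<open>c\<close> too, so subadditivity gives \<open>\<parallel>w\<parallel> \<le> \<Sum>c\<^sub>x q x\<close>.\<close>

lemma norm_sum_le_norm_sum_delta:
  assumes A: "finite A"
  shows "norm (\<Sum>x\<in>A. c x *\<^sub>R x) \<le> norm (\<Sum>x\<in>A. c x *\<^sub>R lipfree_delta x)"
proof -
  define w where "w = (\<Sum>x\<in>A. c x *\<^sub>R x)"
  obtain p where p: "sublinear p" "\<And>x. p x \<le> norm x" "p (- w) \<le> - norm w"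
    using sublinear_step[OF sublinear_norm] by blast
  obtain q where q: "sublinear q" "\<And>x. q x \<le> p x" "\<And>a. a \<in> A \<Longrightarrow> q (- a) = - q a"
    using sublinear_odd_on_finite[OF A p(1)] by blast
  have lip: "1-lipschitz_on UNIV q"
    using p(2) q(2) by (intro sublinear_lipschitz[OF q(1)]) (rule order_trans)
  define f where "f = Lip0 q"
  have f: "lip0_apply f = q"
    unfolding f_def using lip sublinear_zero[OF q(1)] by (intro Lip0_inverse) auto
  have nf: "norm f \<le> 1" by (rule norm_lip0_le) (simp add: f lip)
  have scale: "q (t *\<^sub>R a) = t * q a" if "a \<in> A" for t a
  proof (cases "0 \<le> t")
    case False
    then have "q ((- t) *\<^sub>R (- a)) = (- t) * q (- a)" by (intro sublinear_scale[OF q(1)]) simp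
    then show ?thesis using q(3)[OF that] by simp
  qed (rule sublinear_scale[OF q(1)])
  have "norm w \<le> - q (- w)" using p(3) q(2)[of "- w"] by simp
  also have "\<dots> \<le> q w" using sublinear_neg[OF q(1), of w] by simp
  also have "\<dots> \<le> (\<Sum>x\<in>A. q (c x *\<^sub>R x))" unfolding w_def by (rule sublinear_sum[OF q(1) A])
  also have "\<dots> = blinfun_apply (\<Sum>x\<in>A. c x *\<^sub>R lip0_eval x) f"
    by (simp add: blinfun.sum_left blinfun.scaleR_left f scale)
  also have "\<dots> \<le> norm (\<Sum>x\<in>A. c x *\<^sub>R lip0_eval x) * norm f"
    using norm_blinfun[of "\<Sum>x\<in>A. c x *\<^sub>R lip0_eval x" f] by simp
  also have "\<dots> \<le> norm (\<Sum>x\<in>A. c x *\<^sub>R lip0_eval x)"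
    using mult_left_mono[OF nf norm_ge_zero] by simp
  also have "(\<Sum>x\<in>A. c x *\<^sub>R lip0_eval x) = lipfree_functional (\<Sum>x\<in>A. c x *\<^sub>R lipfree_delta x)"
    by (simp add: linear_sum[OF lipfree_functional_linear]
        linear_scale[OF lipfree_functional_linear] lipfree_delta.rep_eq)
  finally show ?thesis by (simp add: w_def norm_lipfree.rep_eq)
qed

text \<open>The assignment \<open>e i \<mapsto> g i\<close> is handled through its linear span as a relation, the span of the
  pairs \<open>(e i, g i)\<close>. The norm bound makes it single-valued and passes to its closure, which is the graph of
  the extension; the family \<open>e\<close> may thus be linearly dependent.\<close>

lemma bounded_linear_extension_of_dense_span:
  fixes e :: "'i \<Rightarrow> 'a::real_normed_vector" and g :: "'i \<Rightarrow> 'b::banach"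
  assumes dense: "closure (span (range e)) = UNIV"
    and bound: "\<And>u w. (u, w) \<in> span (range (\<lambda>i. (e i, g i))) \<Longrightarrow> norm w \<le> C * norm u"
  obtains T where "bounded_linear T" "\<And>i. T (e i) = g i" "\<And>u. norm (T u) \<le> C * norm u"
proof -
  define P where "P = span (range (\<lambda>i. (e i, g i)))"
  define R where "R = closure P"
  have sub: "subspace R" unfolding R_def P_def by (rule subspace_closure[OF subspace_span])
  have R_bound: "norm w \<le> C * norm u" if "(u, w) \<in> R" for u w
  proof -
    have "closed {z :: 'a \<times> 'b. norm (snd z) \<le> C * norm (fst z)}"
      by (intro closed_Collect_le continuous_intros)
    moreover have "P \<subseteq> {z. norm (snd z) \<le> C * norm (fst z)}" using bound by (auto simp: P_def)
    ultimately have "R \<subseteq> {z. norm (snd z) \<le> C * norm (fst z)}"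
      unfolding R_def by (intro closure_minimal)
    then show ?thesis using that by auto
  qed
  have fst_P: "fst ` P = span (range e)"
  proof -
    have "fst ` range (\<lambda>i. (e i, g i)) = range e" by (simp add: image_image)
    then show ?thesis
      unfolding P_def linear_span_image[OF bounded_linear.linear[OF bounded_linear_fst], symmetric]
      by simp
  qed
  have ex: "\<exists>w. (u, w) \<in> R" for u
  proof -
    have "u \<in> closure (fst ` P)" using dense fst_P by simp
    then obtain s where s: "\<And>n. s n \<in> fst ` P" "s \<longlonglongrightarrow> u" unfolding closure_sequential by blast
    have "\<exists>w. (s n, w) \<in> P" for n using s(1)[of n] by (auto simp: image_iff)
    then obtain v where v: "\<And>n. (s n, v n) \<in> P" by metis
    have "Cauchy v"
    proof (rule metric_CauchyI)
      fix \<epsilon> :: real assume \<epsilon>: "0 < \<epsilon>"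
      have "0 < \<epsilon> / (\<bar>C\<bar> + 1)" using \<epsilon> by simp
      then obtain N where N: "\<And>m n. m \<ge> N \<Longrightarrow> n \<ge> N \<Longrightarrow> dist (s m) (s n) < \<epsilon> / (\<bar>C\<bar> + 1)"
        using metric_CauchyD[OF LIMSEQ_imp_Cauchy[OF s(2)]] by blast
      have "dist (v m) (v n) < \<epsilon>" if "m \<ge> N" "n \<ge> N" for m n
      proof -
        have "(s m, v m) - (s n, v n) \<in> P"
          using v unfolding P_def by (intro span_diff) auto
        then have "norm (v m - v n) \<le> C * norm (s m - s n)" using bound by (simp add: P_def)
        also have "\<dots> \<le> (\<bar>C\<bar> + 1) * norm (s m - s n)" by (intro mult_right_mono) auto
        also have "\<dots> < (\<bar>C\<bar> + 1) * (\<epsilon> / (\<bar>C\<bar> + 1))"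
          using N[OF that] by (intro mult_strict_left_mono) (auto simp: dist_norm)
        also have "\<dots> = \<epsilon>" by simp
        finally show ?thesis by (simp add: dist_norm)
      qed
      then show "\<exists>N. \<forall>m\<ge>N. \<forall>n\<ge>N. dist (v m) (v n) < \<epsilon>" by blast
    qed
    then obtain w where "v \<longlonglongrightarrow> w" using Cauchy_convergent convergent_def by blast
    then have "(\<lambda>n. (s n, v n)) \<longlonglongrightarrow> (u, w)" using s(2) by (intro tendsto_Pair)
    then have "(u, w) \<in> R"
      unfolding R_def closure_sequential using v by (intro exI[of _ "\<lambda>n. (s n, v n)"]) simp
    then show ?thesis ..
  qed
  have unique: "w = w'" if "(u, w) \<in> R" "(u, w') \<in> R" for u w w'
    using R_bound[of 0 "w - w'"] subspace_diff[OF sub that] by simp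
  define T where "T u = (THE w. (u, w) \<in> R)" for u
  have T_in: "(u, T u) \<in> R" for u
    unfolding T_def by (rule theI') (use ex[of u] unique in blast)
  have T_eq: "T u = w" if "(u, w) \<in> R" for u w using T_in that by (rule unique)
  show thesis
  proof
    show bnd: "norm (T u) \<le> C * norm u" for u using R_bound[OF T_in] .
    show "T (e i) = g i" for i
      by (rule T_eq)
        (auto simp: R_def P_def intro!: subsetD[OF closure_subset, of "(e i, g i)"] span_base)
    show "bounded_linear T"
    proof (rule bounded_linear_intro[where K = C])
      show "T (x + y) = T x + T y" for x y
        using subspace_add[OF sub T_in[of x] T_in[of y]] by (intro T_eq) simp
      show "T (r *\<^sub>R x) = r *\<^sub>R T x" for r x
        using subspace_scale[OF sub T_in[of x], of r] by (intro T_eq) simp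
      show "norm (T x) \<le> norm x * C" for x using bnd[of x] by (simp add: mult.commute)
    qed
  qed
qed

lemma barycentre_exists:
  obtains b :: "'a::banach lipfree \<Rightarrow>\<^sub>L 'a"
  where "\<And>x. b (lipfree_delta x) = x" "\<And>\<mu>. norm (b \<mu>) \<le> norm \<mu>"
proof -
  have bound: "norm w \<le> 1 * norm u" if "(u, w) \<in> span (range (\<lambda>x::'a. (lipfree_delta x, x)))" for u w
  proof -
    have inj: "inj (\<lambda>x::'a. (lipfree_delta x, x))" by (auto intro: injI)
    have "\<exists>S r. (u, w) = (\<Sum>z\<in>S. r z *\<^sub>R z) \<and> finite S \<and> S \<subseteq> range (\<lambda>x::'a. (lipfree_delta x, x))"
      using that by (simp only: span_explicit mem_Collect_eq)
    then obtain S r where uw: "(u, w) = (\<Sum>z\<in>S. r z *\<^sub>R z)"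
      and S: "finite S" "S \<subseteq> range (\<lambda>x::'a. (lipfree_delta x, x))"
      by (elim exE conjE)
    obtain A where A: "S = (\<lambda>x. (lipfree_delta x, x)) ` A" "finite A"
      using finite_subset_image[OF S] by metis
    define c where "c x = r (lipfree_delta x, x)" for x
    have "(u, w) = (\<Sum>x\<in>A. c x *\<^sub>R (lipfree_delta x, x))"
      unfolding uw A(1) sum.reindex[OF inj_on_subset[OF inj subset_UNIV]]
      by (simp only: o_def c_def)
    also have "\<dots> = (\<Sum>x\<in>A. c x *\<^sub>R lipfree_delta x, \<Sum>x\<in>A. c x *\<^sub>R x)"
      by (simp only: scaleR_Pair sum_prod)
    finally have "u = (\<Sum>x\<in>A. c x *\<^sub>R lipfree_delta x)" "w = (\<Sum>x\<in>A. c x *\<^sub>R x)" by simp_all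
    then show ?thesis using norm_sum_le_norm_sum_delta[OF A(2), of c] by (simp only: mult_1)
  qed
  show thesis
  proof (rule bounded_linear_extension_of_dense_span[OF lipfree_delta_dense bound])
    fix T :: "'a lipfree \<Rightarrow> 'a"
    assume T: "bounded_linear T" "\<And>x. T (lipfree_delta x) = x" "\<And>\<mu>. norm (T \<mu>) \<le> 1 * norm \<mu>"
    show thesis
      by (rule that[of "Blinfun T"])
        (use T(2,3) in \<open>simp_all add: bounded_linear_Blinfun_apply[OF T(1)]\<close>)
  qed
qed

lemma barycentre_delta [simp]: "blinfun_apply barycentre (lipfree_delta x) = x"
  and norm_barycentre_le: "norm (blinfun_apply barycentre \<mu>) \<le> norm \<mu>"
  for x :: "'a::banach" and \<mu> :: "'a lipfree"
proof -
  obtain b :: "'a lipfree \<Rightarrow>\<^sub>L 'a"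
    where b: "\<And>x. b (lipfree_delta x) = x" "\<And>\<mu>. norm (b \<mu>) \<le> norm \<mu>"
    using barycentre_exists by blast
  have "barycentre = b"
    unfolding barycentre_def using b(1) by (intro the_equality lipfree_blinfun_eqI) auto
  then show "blinfun_apply barycentre (lipfree_delta x) = x"
    and "norm (blinfun_apply barycentre \<mu>) \<le> norm \<mu>"
    using b by auto
qed

section \<open>Existence of the shifts\<close>

lift_definition lip0_translate :: "'a::real_normed_vector \<Rightarrow> 'a lip0 \<Rightarrow> 'a lip0"
  is "\<lambda>a f x. f (x + a) - f a"
proof -
  fix a and f :: "'a \<Rightarrow> real"
  assume "f 0 = 0 \<and> (\<exists>L. L-lipschitz_on UNIV f)"
  then obtain L where L: "L-lipschitz_on UNIV f" by blast
  have "L-lipschitz_on UNIV (\<lambda>x. f (x + a) - f a)"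
    using lipschitz_on_nonneg[OF L] lipschitz_onD[OF L, of "x + a" "y + a" for x y]
    by (intro lipschitz_onI) (auto simp: dist_real_def dist_norm)
  then show "f (0 + a) - f a = 0 \<and> (\<exists>L. L-lipschitz_on UNIV (\<lambda>x. f (x + a) - f a))" by auto
qed

lemma bounded_linear_lip0_translate: "bounded_linear (lip0_translate a)"
proof (rule bounded_linear_intro[where K = 1])
  show "lip0_translate a (f + g) = lip0_translate a f + lip0_translate a g" for f g
    by transfer (simp add: fun_eq_iff)
  show "lip0_translate a (r *\<^sub>R f) = r *\<^sub>R lip0_translate a f" for r f
    by transfer (simp add: fun_eq_iff algebra_simps)
  fix f :: "'a lip0"
  have "norm (lip0_translate a f) \<le> norm f"
  proof (rule norm_lip0_le)
    show "(norm f)-lipschitz_on UNIV (lip0_apply (lip0_translate a f))"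
      using lipschitz_onD[OF norm_lip0_lipschitz[of f], of "x + a" "y + a" for x y]
      by (intro lipschitz_onI) (auto simp: dist_real_def dist_norm lip0_translate.rep_eq)
  qed
  then show "norm (lip0_translate a f) \<le> norm f * 1" by simp
qed

lemma lipfree_shift_exists:
  obtains S :: "'a::real_normed_vector lipfree \<Rightarrow>\<^sub>L 'a lipfree"
  where "\<And>x. S (lipfree_delta x) = lipfree_delta (x + a) - lipfree_delta a"
proof -
  define \<tau> where "\<tau> = Blinfun (lip0_translate a)"
  \<comment> \<open>the adjoint of the translation, which maps the span of the evaluations to itself\<close>
  define adj where "adj \<phi> = \<phi> o\<^sub>L \<tau>" for \<phi> :: "'a lip0 \<Rightarrow>\<^sub>L real"
  let ?E = "span (range (lip0_eval :: 'a \<Rightarrow> _))"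
  have adj: "bounded_linear adj" unfolding adj_def 
    by (rule bounded_bilinear.bounded_linear_left[OF bounded_bilinear_blinfun_compose])
  have \<tau>: "blinfun_apply \<tau> = lip0_translate a"
    unfolding \<tau>_def by (rule bounded_linear_Blinfun_apply[OF bounded_linear_lip0_translate])
  have adj_eval: "adj (lip0_eval x) = lip0_eval (x + a) - lip0_eval a" for x
    by (rule blinfun_eqI) (simp add: adj_def \<tau> lip0_translate.rep_eq blinfun.diff_left)
  have "adj ` ?E \<subseteq> ?E"
    unfolding linear_span_image[OF bounded_linear.linear[OF adj], symmetric]
    by (intro span_minimal subspace_span image_subsetI)
      (clarsimp simp: adj_eval, intro span_diff span_base rangeI)
  then have "adj ` closure ?E \<subseteq> closure ?E"
    using closure_subset[of ?E]
    by (intro image_closure_subset linear_continuous_on[OF adj]) auto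
  then have mem: "adj (lipfree_functional \<mu>) \<in> closure ?E" for \<mu>
    using lipfree_functional[of \<mu>] by blast
  define S where "S \<mu> = Abs_lipfree (adj (lipfree_functional \<mu>))" for \<mu>
  have S: "lipfree_functional (S \<mu>) = adj (lipfree_functional \<mu>)" for \<mu>
    unfolding S_def by (rule Abs_lipfree_inverse[OF mem])
  have "bounded_linear S"
  proof -
    obtain K where K: "\<And>\<phi>. norm (adj \<phi>) \<le> norm \<phi> * K" using bounded_linear.bounded[OF adj] by blast
    show ?thesis
      by (rule bounded_linear_intro[where K = K])
        (simp_all add: lipfree_functional_inject[symmetric] S plus_lipfree.rep_eq
          scaleR_lipfree.rep_eq norm_lipfree.rep_eq linear_add[OF bounded_linear.linear[OF adj]]
          linear_scale[OF bounded_linear.linear[OF adj]] K)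
  qed
  moreover have "S (lipfree_delta x) = lipfree_delta (x + a) - lipfree_delta a" for x
    by (simp add: lipfree_functional_inject[symmetric] S minus_lipfree.rep_eq
        lipfree_delta.rep_eq adj_eval)
  ultimately show thesis
    by (intro that[of "Blinfun S"]) (simp add: bounded_linear_Blinfun_apply)
qed

lemma lipfree_shift_delta [simp]:
  "blinfun_apply (lipfree_shift a) (lipfree_delta x) = lipfree_delta (x + a) - lipfree_delta a"
proof -
  obtain S :: "'a lipfree \<Rightarrow>\<^sub>L 'a lipfree"
    where S: "\<And>x. S (lipfree_delta x) = lipfree_delta (x + a) - lipfree_delta a"
    using lipfree_shift_exists by blast
  have "lipfree_shift a = S"
    unfolding lipfree_shift_def using S by (intro the_equality lipfree_blinfun_eqI) auto
  then show ?thesis using S by simp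
qed

section \<open>Point masses modulo their additivity defects\<close>

lemma norm_lipfree_delta_diff: "norm (lipfree_delta x - lipfree_delta y) \<le> norm (x - y)"
proof -
  have "norm (lip0_eval x - lip0_eval y) \<le> norm (x - y)"
  proof (rule norm_blinfun_bound)
    fix f :: "'a lip0"
    show "norm (blinfun_apply (lip0_eval x - lip0_eval y) f) \<le> norm (x - y) * norm f"
      using lipschitz_onD[OF norm_lip0_lipschitz[of f], of x y]
      by (simp add: blinfun.diff_left dist_norm mult.commute)
  qed simp
  then show ?thesis by transfer
qed

lemma lipfree_delta_zero [simp]: "lipfree_delta 0 = 0"
proof -
  have "lip0_eval 0 = (0 :: 'a lip0 \<Rightarrow>\<^sub>L real)"
    by (rule blinfun_eqI) (simp, transfer, simp)
  then show ?thesis by transfer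
qed

lemma continuous_lipfree_delta: "continuous_on UNIV lipfree_delta"
proof -
  have "1-lipschitz_on UNIV (lipfree_delta :: 'a \<Rightarrow> _)"
    by (rule lipschitz_onI) (simp_all add: dist_norm norm_lipfree_delta_diff)
  then show ?thesis by (rule lipschitz_on_continuous_on)
qed

text \<open>Cauchy's functional equation modulo \<open>Z\<close>: additivity gives homogeneity for integer and then for
  rational scalars, and the set of scalars for which it holds is closed.\<close>

lemma additive_modulo_imp_homogeneous_modulo:
  fixes h :: "'a::real_normed_vector \<Rightarrow> 'b::real_normed_vector"
  assumes sub: "subspace Z" and cl: "closed Z" and cont: "continuous_on UNIV h"
    and add: "\<And>x y. h (x + y) - h x - h y \<in> Z"
  shows "h (t *\<^sub>R x) - t *\<^sub>R h x \<in> Z"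
proof -
  note Z = subspace_add[OF sub] subspace_diff[OF sub] subspace_neg[OF sub] subspace_scale[OF sub]
  have zero: "h 0 \<in> Z" using Z(3)[OF add[of 0 0]] by simp
  have nat: "h (real n *\<^sub>R y) - real n *\<^sub>R h y \<in> Z" for n y
  proof (induction n)
    case (Suc n)
    have "h (real (Suc n) *\<^sub>R y) - real (Suc n) *\<^sub>R h y =
        (h (real n *\<^sub>R y + y) - h (real n *\<^sub>R y) - h y) + (h (real n *\<^sub>R y) - real n *\<^sub>R h y)"
      by (simp add: algebra_simps)
    then show ?case using Z(1)[OF add[of "real n *\<^sub>R y" y] Suc] by (simp only:)
  qed (simp add: zero)
  have odd: "h (- y) + h y \<in> Z" for y
    using Z(2)[OF zero add[of y "- y"]] by (simp add: algebra_simps)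
  have int: "h (of_int m *\<^sub>R y) - of_int m *\<^sub>R h y \<in> Z" for m y
  proof (cases m)
    case (nonneg n)
    then show ?thesis using nat[of n y] by simp
  next
    case (neg n)
    then have eq: "real_of_int m = - real (Suc n)" by simp
    show ?thesis
      using Z(2)[OF odd[of "real (Suc n) *\<^sub>R y"] nat[of "Suc n" y]]
      by (simp add: eq del: of_nat_Suc)
  qed
  have rat: "h (r *\<^sub>R x) - r *\<^sub>R h x \<in> Z" if r: "r \<in> \<rat>" for r
  proof -
    obtain m n where mn: "r = of_int m / of_int n" "0 < n" using Rats_cases'[OF r] by metis
    have "(h (of_int n *\<^sub>R r *\<^sub>R x) - of_int m *\<^sub>R h x)
        - (h (of_int n *\<^sub>R r *\<^sub>R x) - of_int n *\<^sub>R h (r *\<^sub>R x)) \<in> Z"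
      using Z(2)[OF int[of m x] int[of n "r *\<^sub>R x"]] mn by simp
    \<comment> \<open>both terms contain \<open>h (m x)\<close>, as \<open>n r = m\<close>; it cancels\<close>
    then have "(1 / of_int n) *\<^sub>R (of_int n *\<^sub>R h (r *\<^sub>R x) - of_int m *\<^sub>R h x) \<in> Z"
      by (intro Z(4)) simp
    then show ?thesis using mn by (simp add: scaleR_diff_right)
  qed
  have "closed ((\<lambda>t. h (t *\<^sub>R x) - t *\<^sub>R h x) -` Z)"
    by (intro closed_vimage cl continuous_intros continuous_on_compose2[OF cont]) auto
  then have "closure \<rat> \<subseteq> (\<lambda>t. h (t *\<^sub>R x) - t *\<^sub>R h x) -` Z"
    using rat by (intro closure_minimal) auto
  moreover have "t \<in> closure \<rat>"
    unfolding closure_approachable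
  proof (intro allI impI)
    fix e :: real assume "0 < e"
    then obtain r where "r \<in> \<rat>" "t < r" "r < t + e" using Rats_dense_in_real[of t "t + e"] by auto
    then show "\<exists>r\<in>\<rat>. dist r t < e" by (intro bexI[of _ r]) (auto simp: dist_real_def)
  qed
  ultimately show ?thesis by blast
qed

definition delta_defect_space :: "'a::real_normed_vector lipfree set"
  where "delta_defect_space =
    closure (span {lipfree_delta (x + a) - lipfree_delta x - lipfree_delta a | x a. True})"

lemma subspace_delta_defect_space: "subspace delta_defect_space"
  unfolding delta_defect_space_def by (rule subspace_closure[OF subspace_span])

lemma closed_delta_defect_space: "closed delta_defect_space"
  unfolding delta_defect_space_def by simp

lemma delta_defect_mem: "lipfree_delta (x + a) - lipfree_delta x - lipfree_delta a \<in> delta_defect_space"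
  unfolding delta_defect_space_def by (rule subsetD[OF closure_subset], rule span_base) blast

text \<open>The \<open>\<mu>\<close> with this property form a closed set containing the point masses, and a subspace since
  \<open>x \<mapsto> \<delta>\<^sub>x\<close> is linear modulo the defect space.\<close>

lemma minus_delta_barycentre_mem:
  fixes \<mu> :: "'a::banach lipfree"
  shows "\<mu> - lipfree_delta (blinfun_apply barycentre \<mu>) \<in> delta_defect_space"
proof -
  let ?Z = "delta_defect_space :: 'a lipfree set"
  let ?d = "\<lambda>\<mu> :: 'a lipfree. \<mu> - lipfree_delta (blinfun_apply barycentre \<mu>)"
  note Z = subspace_0[OF subspace_delta_defect_space] subspace_add[OF subspace_delta_defect_space]
    subspace_diff[OF subspace_delta_defect_space] subspace_scale[OF subspace_delta_defect_space]
  have "subspace (?d -` ?Z)"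
  proof (rule subspaceI)
    show "0 \<in> ?d -` ?Z" using Z(1) by (simp add: blinfun.zero_right)
  next
    fix \<mu> \<nu> assume *: "\<mu> \<in> ?d -` ?Z" "\<nu> \<in> ?d -` ?Z"
    let ?x = "blinfun_apply barycentre \<mu>" and ?y = "blinfun_apply barycentre \<nu>"
    have "?d (\<mu> + \<nu>) = (?d \<mu> + ?d \<nu>) - (lipfree_delta (?x + ?y) - lipfree_delta ?x - lipfree_delta ?y)"
      by (simp add: blinfun.add_right)
    also have "\<dots> \<in> ?Z" 
      by (rule Z(3)[OF Z(2) delta_defect_mem]) (use * in auto)
    finally show "\<mu> + \<nu> \<in> ?d -` ?Z" by simp
  next
    fix t \<mu> assume *: "\<mu> \<in> ?d -` ?Z"
    let ?x = "blinfun_apply barycentre \<mu>"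
    have "?d (t *\<^sub>R \<mu>) = t *\<^sub>R ?d \<mu> - (lipfree_delta (t *\<^sub>R ?x) - t *\<^sub>R lipfree_delta ?x)"
      by (simp add: blinfun.scaleR_right algebra_simps)
    also have "\<dots> \<in> ?Z"
      by (rule Z(3)[OF Z(4) additive_modulo_imp_homogeneous_modulo[OF
            subspace_delta_defect_space closed_delta_defect_space continuous_lipfree_delta
            delta_defect_mem]]) (use * in simp)
    finally show "t *\<^sub>R \<mu> \<in> ?d -` ?Z" by simp
  qed
  then have "span (range lipfree_delta) \<subseteq> ?d -` ?Z"
    by (intro span_minimal) (auto simp: Z)
  moreover have "closed (?d -` ?Z)"
    by (intro closed_vimage closed_delta_defect_space continuous_intros
        continuous_on_compose2[OF continuous_lipfree_delta]) auto
  ultimately show ?thesis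
    using closure_minimal[of "span (range lipfree_delta)" "?d -` ?Z"] lipfree_delta_dense by auto
qed

section \<open>The kernel of the barycentre map and its quotient\<close>

lemma delta_defect_space_subset_shift_space: "delta_defect_space \<subseteq> shift_space"
proof -
  have "lipfree_delta (x + a) - lipfree_delta x - lipfree_delta a
      = blinfun_apply (lipfree_shift a) (lipfree_delta x) - lipfree_delta x" for x a :: 'a
    by simp
  then show ?thesis
    unfolding delta_defect_space_def shift_space_def
    by (intro closure_mono span_mono) blast
qed

lemma barycentre_shift:
  "blinfun_apply barycentre (blinfun_apply (lipfree_shift a) \<mu>) = blinfun_apply barycentre \<mu>"
proof -
  have "barycentre o\<^sub>L lipfree_shift a = barycentre"
    by (rule lipfree_blinfun_eqI) (simp add: blinfun.diff_right)
  then show ?thesis by (metis blinfun_apply_blinfun_compose)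
qed

lemma shift_space_subset_ker_barycentre: "shift_space \<subseteq> ker_barycentre"
  unfolding shift_space_def
proof (rule closure_minimal)
  show "span {blinfun_apply (lipfree_shift a) \<mu> - \<mu> | a \<mu>. True} \<subseteq> ker_barycentre"
    by (rule span_minimal)
      (auto simp: ker_barycentre_def subspace_def blinfun.bilinear_simps barycentre_shift)
  show "closed (ker_barycentre :: 'a lipfree set)"
    unfolding ker_barycentre_def by (intro closed_Collect_eq continuous_intros)
qed

lemma ker_barycentre_subset_delta_defect_space: "ker_barycentre \<subseteq> delta_defect_space"
proof
  fix \<mu> :: "'a lipfree" assume "\<mu> \<in> ker_barycentre"
  then show "\<mu> \<in> delta_defect_space"
    using minus_delta_barycentre_mem[of \<mu>] by (simp add: ker_barycentre_def)
qed

text \<open>The infimum defining the quotient norm is attained at the point mass \<open>\<delta>\<^bsub>\<beta>\<mu>\<^esub>\<close>.\<close>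

lemma norm_lipfree_quot_class: "norm (lipfree_class \<mu>) = norm (blinfun_apply barycentre \<mu>)"
proof (rule antisym)
  have "lipfree_class \<mu> = lipfree_class (lipfree_delta (blinfun_apply barycentre \<mu>))"
    by (simp add: lipfree_class_eq_iff ker_barycentre_def blinfun.diff_right)
  then have "norm (lipfree_class \<mu>) \<le> norm (lipfree_delta (blinfun_apply barycentre \<mu>))"
    using norm_lipfree_class_le by metis
  also have "\<dots> \<le> norm (blinfun_apply barycentre \<mu>)"
    using norm_lipfree_delta_diff[of "blinfun_apply barycentre \<mu>" 0] by simp
  finally show "norm (lipfree_class \<mu>) \<le> norm (blinfun_apply barycentre \<mu>)" .
  show "norm (blinfun_apply barycentre \<mu>) \<le> norm (lipfree_class \<mu>)"
    unfolding norm_lipfree_quot_def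
  proof (rule cINF_greatest[OF lipfree_class_nonempty])
    fix \<nu> assume "\<nu> \<in> {\<nu>. lipfree_class \<nu> = lipfree_class \<mu>}"
    then have "blinfun_apply barycentre \<nu> = blinfun_apply barycentre \<mu>"
      by (simp add: lipfree_class_eq_iff ker_barycentre_def blinfun.diff_right)
    then show "norm (blinfun_apply barycentre \<mu>) \<le> norm \<nu>" by (metis norm_barycentre_le)
  qed
qed

lift_definition quot_barycentre :: "'a::banach lipfree_quot \<Rightarrow> 'a" is "blinfun_apply barycentre"
  by (simp add: ker_barycentre_def blinfun.diff_right)

theorem mainTheorem4:
  "(ker_barycentre :: 'a::banach lipfree set) = shift_space \<and>
   (shift_space :: 'a lipfree set) =
     closure (span {lipfree_delta (x + a) - lipfree_delta x - lipfree_delta a | x a. True}) \<and>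
   (\<exists>T :: 'a lipfree_quot \<Rightarrow> 'a.
      (\<forall>\<mu>. T (lipfree_class \<mu>) = blinfun_apply barycentre \<mu>) \<and>
      linear T \<and> bij T \<and> (\<forall>q. norm (T q) = norm q))"
proof (intro conjI exI[of _ quot_barycentre] allI)
  show "(ker_barycentre :: 'a lipfree set) = shift_space"
    using ker_barycentre_subset_delta_defect_space delta_defect_space_subset_shift_space
      shift_space_subset_ker_barycentre by blast
  show "(shift_space :: 'a lipfree set) =
     closure (span {lipfree_delta (x + a) - lipfree_delta x - lipfree_delta a | x a. True})"
    unfolding delta_defect_space_def[symmetric]
    using ker_barycentre_subset_delta_defect_space delta_defect_space_subset_shift_space
      shift_space_subset_ker_barycentre by blast
  show on_class: "quot_barycentre (lipfree_class \<mu>) = blinfun_apply barycentre \<mu>" for \<mu> :: "'a lipfree"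
    by (rule quot_barycentre.abs_eq)
  show lin: "linear (quot_barycentre :: 'a lipfree_quot \<Rightarrow> 'a)"
    by (rule linearI) (transfer; simp add: blinfun.bilinear_simps)+
  show iso: "norm (quot_barycentre q) = norm q" for q :: "'a lipfree_quot"
    using lipfree_class_surj[of q] by (metis on_class norm_lipfree_quot_class)
  show "bij (quot_barycentre :: 'a lipfree_quot \<Rightarrow> 'a)"
  proof (rule bijI)
    show "inj (quot_barycentre :: 'a lipfree_quot \<Rightarrow> 'a)"
      unfolding linear_injective_0[OF lin] by (metis iso norm_eq_zero)
    show "surj (quot_barycentre :: 'a lipfree_quot \<Rightarrow> 'a)"
      by (rule surjI[where f = "\<lambda>x. lipfree_class (lipfree_delta x)"]) (simp add: on_class)
  qed
qed

end
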